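(* The $3$-dimensional Heisenberg group $\mathcal{H}$ has one end.
   Context: The $3$-dimensional Heisenberg group is given by the presentation $\mathcal{H}=\langle a,b,c\mid [a,b]=c,\ [a,c]=1=[b,c]\rangle$. One end: a finitely generated infinite group $G$ has one end if for some (equivalently every) finite generating set $T$, for every $n$ the complement in the Cayley graph ${\rm Cay}(G,T)$ of the ball of radius $n$ about the identity has exactly one unbounded connected component. *)

theory Defs
  imports "HOL-Algebra.Generated_Groups"
begin

text \<open>A letter \<open>(x, True)\<close> stands for the generator \<open>x\<close> and \<open>(x, False)\<close> for its inverse.\<close>

type_synonym 'g word = "('g \<times> bool) list"

definition inv_word :: "'g word \<Rightarrow> 'g word" where
  "inv_word w = map (\<lambda>(x, s). (x, \<not> s)) (rev w)"

definition commutator_word :: "'g word \<Rightarrow> 'g word \<Rightarrow> 'g word" where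
  "commutator_word u v = u @ v @ inv_word u @ inv_word v"

text \<open>The elements of \<open>\<langle>X | R\<rangle>\<close>, where \<open>X\<close> is the whole type of generators and a pair
  \<open>(u, v)\<close> in \<open>R\<close> is the relation \<open>u = v\<close>, are the words modulo the least congruence containing
  free cancellation and \<open>R\<close>.\<close>

inductive pres_eq :: "('g word \<times> 'g word) set \<Rightarrow> 'g word \<Rightarrow> 'g word \<Rightarrow> bool"
  for R where
  refl: "pres_eq R u u"
| sym: "pres_eq R u v \<Longrightarrow> pres_eq R v u"
| trans: "pres_eq R u v \<Longrightarrow> pres_eq R v w \<Longrightarrow> pres_eq R u w"
| append: "pres_eq R u u' \<Longrightarrow> pres_eq R v v' \<Longrightarrow> pres_eq R (u @ v) (u' @ v')"
| cancel: "pres_eq R [(x, s), (x, \<not> s)] []"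
| rel: "(u, v) \<in> R \<Longrightarrow> pres_eq R u v"

definition pres_rel :: "('g word \<times> 'g word) set \<Rightarrow> ('g word \<times> 'g word) set" where
  "pres_rel R = {(u, v). pres_eq R u v}"

definition presented_group :: "('g word \<times> 'g word) set \<Rightarrow> 'g word set monoid" where
  "presented_group R =
    \<lparr>carrier = UNIV // pres_rel R,
     mult = (\<lambda>U V. \<Union>u\<in>U. \<Union>v\<in>V. pres_rel R `` {u @ v}),
     one = pres_rel R `` {[]}\<rparr>"

lemma equiv_pres_rel: "equiv UNIV (pres_rel R)"
  by (intro equivI refl_onI symI transI)
     (auto simp: pres_rel_def intro: pres_eq.refl pres_eq.sym pres_eq.trans)

lemma pres_class_eq_iff: "pres_rel R `` {u} = pres_rel R `` {v} \<longleftrightarrow> pres_eq R u v"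
  using eq_equiv_class_iff[OF equiv_pres_rel, of u v] by (simp add: pres_rel_def)

lemma pres_mult_class:
  "pres_rel R `` {u} \<otimes>\<^bsub>presented_group R\<^esub> pres_rel R `` {v} = pres_rel R `` {u @ v}"
proof -
  have "congruent2 (pres_rel R) (pres_rel R) (\<lambda>u v. pres_rel R `` {u @ v})"
    unfolding congruent2_def pres_class_eq_iff by (auto simp: pres_rel_def intro: pres_eq.append)
  from UN_equiv_class2[OF equiv_pres_rel equiv_pres_rel this] show ?thesis
    by (simp add: presented_group_def)
qed

lemma pres_eq_inv_word: "pres_eq R (inv_word w @ w) []"
proof (induction w)
  case Nil
  show ?case by (simp add: inv_word_def pres_eq.refl)
next
  case (Cons p w)
  obtain x s where p: "p = (x, s)" by (cases p)
  have "pres_eq R ([(x, \<not> s), (x, \<not> \<not> s)] @ w) ([] @ w)"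
    by (intro pres_eq.append pres_eq.cancel pres_eq.refl)
  then have "pres_eq R (inv_word w @ [(x, \<not> s), (x, s)] @ w) (inv_word w @ w)"
    by (intro pres_eq.append pres_eq.refl) simp
  then show ?case
    using Cons.IH by (auto simp: p inv_word_def intro: pres_eq.trans)
qed

lemma group_presented_group: "group (presented_group R)"
proof (rule groupI)
  fix U assume "U \<in> carrier (presented_group R)"
  then obtain u where U: "U = pres_rel R `` {u}"
    by (auto simp: presented_group_def elim: quotientE)
  have one: "\<one>\<^bsub>presented_group R\<^esub> = pres_rel R `` {[]}" by (simp add: presented_group_def)
  show "\<one>\<^bsub>presented_group R\<^esub> \<otimes>\<^bsub>presented_group R\<^esub> U = U"
    by (simp add: U one pres_mult_class)
  have "pres_rel R `` {inv_word u} \<otimes>\<^bsub>presented_group R\<^esub> U = \<one>\<^bsub>presented_group R\<^esub>"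
    by (simp add: U one pres_mult_class pres_class_eq_iff pres_eq_inv_word)
  then show "\<exists>V\<in>carrier (presented_group R). V \<otimes>\<^bsub>presented_group R\<^esub> U = \<one>\<^bsub>presented_group R\<^esub>"
    by (intro bexI) (auto simp: presented_group_def intro: quotientI)
next
  fix U V assume "U \<in> carrier (presented_group R)" "V \<in> carrier (presented_group R)"
  then obtain u v where UV: "U = pres_rel R `` {u}" "V = pres_rel R `` {v}"
    by (auto simp: presented_group_def elim!: quotientE)
  show "U \<otimes>\<^bsub>presented_group R\<^esub> V \<in> carrier (presented_group R)"
    unfolding UV pres_mult_class by (simp add: presented_group_def quotientI)
  fix W assume "W \<in> carrier (presented_group R)"
  then obtain w where W: "W = pres_rel R `` {w}"
    by (auto simp: presented_group_def elim!: quotientE)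
  show "U \<otimes>\<^bsub>presented_group R\<^esub> V \<otimes>\<^bsub>presented_group R\<^esub> W =
        U \<otimes>\<^bsub>presented_group R\<^esub> (V \<otimes>\<^bsub>presented_group R\<^esub> W)"
    unfolding UV W pres_mult_class by simp
qed (simp add: presented_group_def quotientI)

datatype heis_gen = Gen_a | Gen_b | Gen_c

definition heisenberg_relations :: "(heis_gen word \<times> heis_gen word) set" where
  "heisenberg_relations =
    (let a = [(Gen_a, True)]; b = [(Gen_b, True)]; c = [(Gen_c, True)]
     in {(commutator_word a b, c), (commutator_word a c, []), (commutator_word b c, [])})"

definition heisenberg_group :: "heis_gen word set monoid" where
  "heisenberg_group = presented_group heisenberg_relations"

text \<open>A graph on the vertex set \<open>carrier G\<close> is given by its symmetric adjacency relation.
  \<open>T\<close> need not be closed under inverses. If \<open>T\<close> contains the identity, the resulting loops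
  affect neither balls nor components.\<close>

definition cayley_adj :: "('a, 'b) monoid_scheme \<Rightarrow> 'a set \<Rightarrow> ('a \<times> 'a) set" where
  "cayley_adj G T =
    {(g, h). g \<in> carrier G \<and> h \<in> carrier G \<and> (\<exists>t\<in>T. h = g \<otimes>\<^bsub>G\<^esub> t \<or> g = h \<otimes>\<^bsub>G\<^esub> t)}"

definition cayley_ball :: "('a, 'b) monoid_scheme \<Rightarrow> 'a set \<Rightarrow> nat \<Rightarrow> 'a set" where
  "cayley_ball G T n = {g. \<exists>k\<le>n. (\<one>\<^bsub>G\<^esub>, g) \<in> cayley_adj G T ^^ k}"

definition induced_components :: "('a \<times> 'a) set \<Rightarrow> 'a set \<Rightarrow> 'a set set" where
  "induced_components E U = U // {(x, y). x \<in> U \<and> y \<in> U \<and> (x, y) \<in> (E \<inter> U \<times> U)\<^sup>*}"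

definition cayley_bounded :: "('a, 'b) monoid_scheme \<Rightarrow> 'a set \<Rightarrow> 'a set \<Rightarrow> bool" where
  "cayley_bounded G T C \<longleftrightarrow> (\<exists>m. C \<subseteq> cayley_ball G T m)"

text \<open>The condition does not depend on the finite generating set \<open>T\<close>, so it is asked for some \<open>T\<close>.\<close>

definition has_one_end :: "('a, 'b) monoid_scheme \<Rightarrow> bool" where
  "has_one_end G \<longleftrightarrow>
    group G \<and> infinite (carrier G) \<and>
    (\<exists>T. finite T \<and> T \<subseteq> carrier G \<and> generate G T = carrier G \<and>
      (\<forall>n. \<exists>!C. C \<in> induced_components (cayley_adj G T) (carrier G - cayley_ball G T n)
                \<and> \<not> cayley_bounded G T C))"

end

theory Submission
  imports Defs
begin

text \<open>Every element of \<open>\<H>\<close> is uniquely \<open>b\<^sup>y a\<^sup>x c\<^sup>z\<close>, and in the coordinates \<open>(x, y, z)\<close> right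
  multiplication by \<open>a\<close>, \<open>b\<close>, \<open>c\<close> adds \<open>(1, 0, 0)\<close>, \<open>(0, 1, x)\<close>, \<open>(0, 0, 1)\<close>. Outside a cube
  \<open>[-N, N]\<^sup>3\<close> any two points are joined by full lines avoiding the cube: a point with \<open>\<bar>y\<bar> > N\<close> or
  \<open>\<bar>z\<bar> > N\<close> moves along its \<open>a\<close>-line to \<open>x = N + 1\<close>, from where its \<open>b\<close>-line leads to
  \<open>y = N + 1\<close>, and in that plane the \<open>c\<close>-lines and \<open>a\<close>-lines lead to \<open>(0, N + 1, 0)\<close>.\<close>

section \<open>A criterion for one-endedness\<close>

lemma sym_cayley_adj: "sym (cayley_adj G T)"
  by (auto simp: sym_def cayley_adj_def)

context group
begin

text \<open>The only neighbours of \<open>g\<close> are \<open>g t\<close> and \<open>g t^-1\<close>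
  with \<open>t\<close> in \<open>T\<close>, so the graph is locally finite.\<close>

lemma finite_cayley_ball:
  assumes "finite T" "T \<subseteq> carrier G"
  shows "finite (cayley_ball G T n)"
proof -
  have nbrs: "finite (cayley_adj G T `` {g})" for g
  proof (rule finite_subset)
    show "cayley_adj G T `` {g} \<subseteq> (\<lambda>t. g \<otimes> t) ` T \<union> (\<lambda>t. g \<otimes> inv t) ` T"
    proof
      fix h assume "h \<in> cayley_adj G T `` {g}"
      then obtain t where h: "h \<in> carrier G" "t \<in> T" "h = g \<otimes> t \<or> g = h \<otimes> t"
        by (auto simp: cayley_adj_def)
      then have "h = h \<otimes> t \<otimes> inv t"
        using assms(2) by (auto simp: m_assoc)
      with h show "h \<in> (\<lambda>t. g \<otimes> t) ` T \<union> (\<lambda>t. g \<otimes> inv t) ` T"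
        by blast
    qed
  qed (use assms(1) in auto)
  have "finite {g. (\<one>, g) \<in> cayley_adj G T ^^ k}" for k
  proof (induction k)
    case (Suc k)
    have "{g. (\<one>, g) \<in> cayley_adj G T ^^ Suc k} =
        (\<Union>h \<in> {h. (\<one>, h) \<in> cayley_adj G T ^^ k}. cayley_adj G T `` {h})"
      by auto
    then show ?case
      using Suc nbrs by simp
  qed simp
  moreover have "cayley_ball G T n = (\<Union>k\<le>n. {g. (\<one>, g) \<in> cayley_adj G T ^^ k})"
    by (auto simp: cayley_ball_def)
  ultimately show ?thesis
    by simp
qed

text \<open>Edges are right multiplications, so left translation by \<open>x\<close> is a graph
  automorphism.\<close>

lemma cayley_adj_left_mult:
  assumes "T \<subseteq> carrier G" "x \<in> carrier G" "(g, h) \<in> (cayley_adj G T)\<^sup>*"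
  shows "(x \<otimes> g, x \<otimes> h) \<in> (cayley_adj G T)\<^sup>*"
  using assms(3)
proof (induction rule: rtrancl_induct)
  case (step h h')
  then obtain t where t: "h \<in> carrier G" "h' \<in> carrier G" "t \<in> T" "h' = h \<otimes> t \<or> h = h' \<otimes> t"
    by (auto simp: cayley_adj_def)
  then have "t \<in> carrier G"
    using assms(1) by auto
  with t have "x \<otimes> h' = x \<otimes> h \<otimes> t \<or> x \<otimes> h = x \<otimes> h' \<otimes> t"
    using assms(2) by (auto simp: m_assoc)
  then have "(x \<otimes> h, x \<otimes> h') \<in> cayley_adj G T"
    using t assms(2) by (auto simp: cayley_adj_def)
  with step.IH show ?case
    by (rule rtrancl_into_rtrancl)
qed simp

text \<open>For a product \<open>h1 h2\<close>, follow a path to \<open>h1\<close> and then the path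
  to \<open>h2\<close> translated by \<open>h1\<close>.\<close>

lemma generate_imp_cayley_reachable:
  assumes T: "T \<subseteq> carrier G" and "g \<in> generate G T"
  shows "(\<one>, g) \<in> (cayley_adj G T)\<^sup>*"
  using assms(2)
proof (induction rule: generate.induct)
  case (incl h)
  then show ?case
    using T by (intro r_into_rtrancl) (auto simp: cayley_adj_def intro!: bexI[of _ h])
next
  case (inv h)
  then have "h \<in> carrier G"
    using T by auto
  with inv show ?case
    by (intro r_into_rtrancl) (auto simp: cayley_adj_def intro!: bexI[of _ h])
next
  case (eng h1 h2)
  have "h1 \<in> carrier G"
    using eng.hyps(1) generate_in_carrier[OF T] by blast
  then have "(h1 \<otimes> \<one>, h1 \<otimes> h2) \<in> (cayley_adj G T)\<^sup>*"
    by (rule cayley_adj_left_mult[OF T _ eng.IH(2)])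
  then show ?case
    using eng.IH(1) \<open>h1 \<in> carrier G\<close> by simp
qed simp

text \<open>Together with \<open>finite_cayley_ball\<close> this lets boundedness of a component be
  read as finiteness.\<close>

lemma finite_imp_cayley_bounded:
  assumes "T \<subseteq> carrier G" "generate G T = carrier G" "finite C" "C \<subseteq> carrier G"
  shows "cayley_bounded G T C"
proof -
  have "\<exists>k. (\<one>, g) \<in> cayley_adj G T ^^ k" if "g \<in> C" for g
    using generate_imp_cayley_reachable[OF assms(1), of g] assms(2,4) that
    by (blast dest: rtrancl_imp_relpow)
  then obtain k where k: "\<And>g. g \<in> C \<Longrightarrow> (\<one>, g) \<in> cayley_adj G T ^^ k g"
    by metis
  have "g \<in> cayley_ball G T (Max (k ` C))" if "g \<in> C" for g
    using k[OF that] assms(3) that by (auto simp: cayley_ball_def intro!: exI[of _ "k g"])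
  then show ?thesis
    by (auto simp: cayley_bounded_def)
qed

text \<open>Replaces balls by arbitrary finite sets \<open>F\<close>. The set \<open>K\<close> may
  exceed \<open>F\<close>, so it can absorb finite components of the complement: all vertices far
  out share one component, and any other component lies in \<open>K\<close>, hence is
  bounded.\<close>

lemma has_one_endI:
  assumes inf: "infinite (carrier G)"
    and T: "finite T" "T \<subseteq> carrier G" "generate G T = carrier G"
    and conn: "\<And>F. \<lbrakk>finite F; F \<subseteq> carrier G\<rbrakk> \<Longrightarrow> \<exists>K. finite K \<and>
      (\<forall>g \<in> carrier G - K. \<forall>h \<in> carrier G - K.
        (g, h) \<in> (cayley_adj G T \<inter> (carrier G - F) \<times> (carrier G - F))\<^sup>*)"
  shows "has_one_end G"
proof -
  have "\<exists>!C. C \<in> induced_components (cayley_adj G T) (carrier G - cayley_ball G T n)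
          \<and> \<not> cayley_bounded G T C" for n
  proof -
    define B where "B = cayley_ball G T n"
    define U where "U = carrier G - B"
    define E where "E = cayley_adj G T \<inter> U \<times> U"
    define R where "R = {(x, y). x \<in> U \<and> y \<in> U \<and> (x, y) \<in> E\<^sup>*}"
    have comps: "induced_components (cayley_adj G T) U = U // R"
      by (simp add: induced_components_def R_def E_def)
    have "sym (E\<^sup>*)"
      using sym_cayley_adj[of G T] by (intro sym_rtrancl) (auto simp: E_def sym_def)
    then have equiv: "equiv U R"
      by (intro equivI refl_onI symI transI) (auto simp: R_def dest: symD)
    have "finite B"
      unfolding B_def by (rule finite_cayley_ball[OF T(1,2)])
    \<comment> \<open>\<open>conn\<close> asks for a subset of the carrier, and this part of the
      ball has the same complement.\<close>
    have "U = carrier G - (B \<inter> carrier G)"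
      by (auto simp: U_def)
    then obtain K where K: "finite K" "\<And>g h. \<lbrakk>g \<in> carrier G - K; h \<in> carrier G - K\<rbrakk> \<Longrightarrow> (g, h) \<in> E\<^sup>*"
      using conn[of "B \<inter> carrier G"] \<open>finite B\<close> unfolding E_def by auto
    \<comment> \<open>\<open>K\<close> is not assumed to contain \<open>B\<close>, so both are
      removed.\<close>
    define L where "L = carrier G - (K \<union> B)"
    have "infinite L"
      unfolding L_def using inf K(1) \<open>finite B\<close> by (intro Diff_infinite_finite) auto
    then obtain p where p: "p \<in> L"
      by (metis finite.emptyI all_not_in_conv)
    have LR: "(g, h) \<in> R" if "g \<in> L" "h \<in> L" for g h
      using that K(2) by (auto simp: L_def R_def U_def)
    have "L \<subseteq> R `` {p}"
      using LR p by blast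
    then have "infinite (R `` {p})"
      using \<open>infinite L\<close> infinite_super by blast
    then have unbdd: "\<not> cayley_bounded G T (R `` {p})"
      using finite_cayley_ball[OF T(1,2)] finite_subset by (auto simp: cayley_bounded_def)
    have pU: "R `` {p} \<in> U // R"
      using p by (auto simp: L_def U_def intro: quotientI)
    show ?thesis
      unfolding B_def[symmetric] U_def[symmetric] comps
    proof (rule ex1I[of _ "R `` {p}"])
      fix C assume C: "C \<in> U // R \<and> \<not> cayley_bounded G T C"
      then have CU: "C \<subseteq> U"
        using in_quotient_imp_subset[OF equiv] by blast
      \<comment> \<open>An unbounded class is infinite, so it leaves \<open>K\<close> and meets
        \<open>L\<close>; distinct classes being disjoint, it is the class of
        \<open>p\<close>.\<close>
      have "infinite C"
        using C CU finite_imp_cayley_bounded[OF T(2,3)] by (auto simp: U_def)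
      then have "\<not> C \<subseteq> K"
        using K(1) finite_subset by blast
      then obtain q where q: "q \<in> C" "q \<in> L"
        using CU by (auto simp: L_def U_def)
      have "q \<in> R `` {p}"
        using q(2) \<open>L \<subseteq> R `` {p}\<close> by blast
      with q show "C = R `` {p}"
        using quotient_disj[OF equiv] C pU by blast
    qed (use pU unbdd in simp)
  qed
  then show ?thesis
    unfolding has_one_end_def using inf T is_group by blast
qed

text \<open>The hypothesis says that conjugation by \<open>y\<close> sends \<open>x\<close> to
  \<open>z\<close>; as a homomorphism it respects all integer powers, negative ones
  included.\<close>

lemma int_pow_intertwine:
  fixes n :: int
  assumes [simp]: "x \<in> carrier G" "y \<in> carrier G" "z \<in> carrier G" and xy: "x \<otimes> y = y \<otimes> z"
  shows "x [^] n \<otimes> y = y \<otimes> z [^] n"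
proof -
  have "(\<lambda>g. inv y \<otimes> g \<otimes> y) \<in> hom G G"
  proof (rule homI)
    fix g h assume "g \<in> carrier G" "h \<in> carrier G"
    moreover from this have "y \<otimes> (inv y \<otimes> (h \<otimes> y)) = h \<otimes> y"
      by (simp add: m_assoc[symmetric])
    ultimately show "inv y \<otimes> (g \<otimes> h) \<otimes> y = (inv y \<otimes> g \<otimes> y) \<otimes> (inv y \<otimes> h \<otimes> y)"
      by (simp add: m_assoc)
  qed simp
  from hom_int_pow[OF this assms(1) is_group is_group]
  have "inv y \<otimes> x [^] n \<otimes> y = (inv y \<otimes> x \<otimes> y) [^] n" .
  also have "inv y \<otimes> x \<otimes> y = z"
    by (simp add: m_assoc xy inv_solve_left')
  finally show ?thesis
    by (metis assms(1-3) int_pow_closed inv_closed inv_solve_left' m_assoc m_closed)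
qed

end

section \<open>Coordinates on the Heisenberg group\<close>

definition heis_elt :: "heis_gen word \<Rightarrow> heis_gen word set" where
  "heis_elt w = pres_rel heisenberg_relations `` {w}"

abbreviation heis_letter :: "heis_gen \<Rightarrow> heis_gen word set" where
  "heis_letter x \<equiv> heis_elt [(x, True)]"

interpretation H: group heisenberg_group
  unfolding heisenberg_group_def by (rule group_presented_group)

abbreviation heis_mult (infixl "\<star>" 70) where
  "g \<star> h \<equiv> g \<otimes>\<^bsub>heisenberg_group\<^esub> h"

lemma heis_elt_carrier [simp]: "heis_elt w \<in> carrier heisenberg_group"
  by (simp add: heis_elt_def heisenberg_group_def presented_group_def quotientI)

lemma heis_elt_cases:
  assumes "g \<in> carrier heisenberg_group"
  obtains w where "g = heis_elt w"
  using assms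
  by (auto simp: heis_elt_def heisenberg_group_def presented_group_def elim: quotientE)

lemma heis_elt_append: "heis_elt (u @ v) = heis_elt u \<star> heis_elt v"
  by (simp add: heis_elt_def heisenberg_group_def pres_mult_class)

lemma heis_elt_Nil: "heis_elt [] = \<one>\<^bsub>heisenberg_group\<^esub>"
  by (simp add: heis_elt_def heisenberg_group_def presented_group_def)

lemma heis_elt_eq_iff: "heis_elt u = heis_elt v \<longleftrightarrow> pres_eq heisenberg_relations u v"
  by (simp add: heis_elt_def pres_class_eq_iff)

lemma heis_elt_inverse_letter:
  "heis_elt [(x, False)] = inv\<^bsub>heisenberg_group\<^esub> heis_letter x"
proof -
  have "heis_elt ([(x, False)] @ [(x, True)]) = heis_elt []"
    using pres_eq.cancel[of heisenberg_relations x False] by (simp add: heis_elt_eq_iff)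
  then show ?thesis
    unfolding heis_elt_append heis_elt_Nil by (simp add: H.inv_equality)
qed

text \<open>Multiply \<open>x y x^-1 y^-1 = w\<close> on the right by \<open>y x\<close>. Keeping
  \<open>w\<close> general covers all three defining relations.\<close>

lemma heis_commutator:
  assumes "(commutator_word [(x, True)] [(y, True)], w) \<in> heisenberg_relations"
  shows "heis_letter x \<star> heis_letter y = heis_elt w \<star> (heis_letter y \<star> heis_letter x)"
proof -
  have "heis_elt ([(x, True)] @ [(y, True)] @ [(x, False)] @ [(y, False)]) = heis_elt w"
    using pres_eq.rel[OF assms] by (simp add: heis_elt_eq_iff commutator_word_def inv_word_def)
  then have "heis_elt w = heis_letter x \<star> heis_letter y \<star>
      (inv\<^bsub>heisenberg_group\<^esub> heis_letter x \<star> inv\<^bsub>heisenberg_group\<^esub> heis_letter y)"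
    unfolding heis_elt_append heis_elt_inverse_letter by (simp add: H.m_assoc)
  then show ?thesis
    by (simp add: H.m_assoc H.inv_mult_group[symmetric])
qed

lemma heis_a_c: "heis_letter Gen_a \<star> heis_letter Gen_c = heis_letter Gen_c \<star> heis_letter Gen_a"
  and heis_b_c: "heis_letter Gen_b \<star> heis_letter Gen_c = heis_letter Gen_c \<star> heis_letter Gen_b"
  using heis_commutator[of Gen_a Gen_c "[]"] heis_commutator[of Gen_b Gen_c "[]"]
  by (simp_all add: heisenberg_relations_def Let_def heis_elt_Nil)

text \<open>The relation gives \<open>a b = c b a\<close>, and \<open>c\<close> commutes with both
  other generators. The form \<open>b (a c)\<close> fits \<open>int_pow_intertwine\<close>.\<close>

lemma heis_a_b: "heis_letter Gen_a \<star> heis_letter Gen_b =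
    heis_letter Gen_b \<star> (heis_letter Gen_a \<star> heis_letter Gen_c)"
proof -
  have "heis_letter Gen_a \<star> heis_letter Gen_b =
      heis_letter Gen_c \<star> heis_letter Gen_b \<star> heis_letter Gen_a"
    using heis_commutator[of Gen_a Gen_b "[(Gen_c, True)]"]
    by (simp add: heisenberg_relations_def Let_def H.m_assoc)
  also have "\<dots> = heis_letter Gen_b \<star> (heis_letter Gen_a \<star> heis_letter Gen_c)"
    by (simp add: heis_a_c heis_b_c[symmetric] H.m_assoc)
  finally show ?thesis .
qed

fun heis_point :: "int \<times> int \<times> int \<Rightarrow> heis_gen word set" where
  "heis_point (x, y, z) = heis_letter Gen_b [^]\<^bsub>heisenberg_group\<^esub> y \<star>
     heis_letter Gen_a [^]\<^bsub>heisenberg_group\<^esub> x \<star> heis_letter Gen_c [^]\<^bsub>heisenberg_group\<^esub> z"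

text \<open>Right multiplication by \<open>g\<^sup>n\<close> in the coordinates of \<open>heis_point\<close>; the term \<open>n * x\<close> comes
  from \<open>a\<^sup>x b\<^sup>n = b\<^sup>n a\<^sup>x c\<^sup>n\<^sup>x\<close>.\<close>

fun heis_shift :: "heis_gen \<Rightarrow> int \<Rightarrow> int \<times> int \<times> int \<Rightarrow> int \<times> int \<times> int" where
  "heis_shift Gen_a n (x, y, z) = (x + n, y, z)"
| "heis_shift Gen_b n (x, y, z) = (x, y + n, z + n * x)"
| "heis_shift Gen_c n (x, y, z) = (x, y, z + n)"

lemma heis_shift_shift [simp]: "heis_shift g m (heis_shift g n p) = heis_shift g (n + m) p"
  by (cases p; cases g) (auto simp: algebra_simps)

lemma heis_shift_0 [simp]: "heis_shift g 0 p = p"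
  by (cases p; cases g) auto

lemma heis_point_carrier [simp]: "heis_point p \<in> carrier heisenberg_group"
  by (cases p) simp

lemma heis_point_letter: "heis_point p \<star> heis_letter g = heis_point (heis_shift g 1 p)"
proof (cases p)
  case (fields x y z)
  let ?a = "heis_letter Gen_a" and ?b = "heis_letter Gen_b" and ?c = "heis_letter Gen_c"
  let ?pow = "\<lambda>g (n :: int). g [^]\<^bsub>heisenberg_group\<^esub> n"
  show ?thesis
  proof (cases g)
    case Gen_a
    have "?pow ?c z \<star> ?a = ?a \<star> ?pow ?c z"
      by (rule H.int_pow_intertwine) (simp_all add: heis_a_c)
    then show ?thesis
      by (simp add: fields Gen_a H.m_assoc H.int_pow_mult)
  next
    case Gen_b
    have cb: "?pow ?c z \<star> ?b = ?b \<star> ?pow ?c z"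
      by (rule H.int_pow_intertwine) (simp_all add: heis_b_c)
    \<comment> \<open>Moving \<open>b\<close> to the left turns \<open>a^x\<close> into
      \<open>(a c)^x\<close>, which splits because \<open>a\<close> and \<open>c\<close> commute;
      the factor \<open>c^x\<close> is what adds \<open>x\<close> to the last coordinate.\<close>
    have "?pow ?a x \<star> ?b = ?b \<star> ?pow (?a \<star> ?c) x"
      by (rule H.int_pow_intertwine) (simp_all add: heis_a_b)
    also have "\<dots> = ?b \<star> (?pow ?a x \<star> ?pow ?c x)"
      by (subst H.int_pow_mult_distrib[OF heis_a_c]) simp_all
    finally have ab: "?pow ?a x \<star> ?b = ?b \<star> (?pow ?a x \<star> ?pow ?c x)" .
    have "heis_point p \<star> ?b = ?pow ?b y \<star> (?pow ?a x \<star> (?pow ?c z \<star> ?b))"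
      by (simp add: fields H.m_assoc)
    also have "\<dots> = ?pow ?b y \<star> (?pow ?a x \<star> ?b \<star> ?pow ?c z)"
      by (simp add: cb H.m_assoc)
    also have "\<dots> = ?pow ?b y \<star> ?b \<star> ?pow ?a x \<star> (?pow ?c x \<star> ?pow ?c z)"
      by (simp add: ab H.m_assoc)
    finally show ?thesis
      by (simp add: fields Gen_b H.int_pow_mult add.commute[of z x])
  next
    case Gen_c
    then show ?thesis
      by (simp add: fields H.m_assoc H.int_pow_mult)
  qed
qed

lemma heis_point_inverse_letter:
  "heis_point p \<star> inv\<^bsub>heisenberg_group\<^esub> heis_letter g = heis_point (heis_shift g (- 1) p)"
  using heis_point_letter[of "heis_shift g (- 1) p" g] by (simp add: H.inv_solve_right')

text \<open>Existence of normal forms: the range contains the identity and is stable under right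
  multiplication by letters, hence the induction from the right end of a word.\<close>

lemma surj_heis_point:
  assumes "g \<in> carrier heisenberg_group"
  shows "g \<in> range heis_point"
proof -
  have "heis_elt w \<in> range heis_point" for w
  proof (induction w rule: rev_induct)
    case Nil
    have "heis_elt [] = heis_point (0, 0, 0)"
      by (simp add: heis_elt_Nil)
    then show ?case by blast
  next
    case (snoc l w)
    then obtain p where p: "heis_elt w = heis_point p"
      by blast
    obtain x s where "l = (x, s)"
      by (cases l)
    then show ?case
      by (cases s)
        (auto simp: heis_elt_append p heis_point_letter heis_elt_inverse_letter heis_point_inverse_letter)
  qed
  with assms show ?thesis
    by (metis heis_elt_cases)
qed

text \<open>The action of words on coordinates, which respects the relations, separates the points.\<close>

definition heis_word_shift :: "heis_gen word \<Rightarrow> int \<times> int \<times> int \<Rightarrow> int \<times> int \<times> int" where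
  "heis_word_shift = fold (\<lambda>(g, s). heis_shift g (if s then 1 else - 1))"

text \<open>\<open>fold\<close> applies the leftmost letter first, so words act from the right; only
  cancellation and the three relations need a computation on coordinates.\<close>

lemma heis_word_shift_cong:
  "pres_eq heisenberg_relations u v \<Longrightarrow> heis_word_shift u = heis_word_shift v"
proof (induction rule: pres_eq.induct)
  case (cancel x s)
  then show ?case
    by (auto simp: heis_word_shift_def fun_eq_iff)
next
  case (rel u v)
  then show ?case
    by (auto simp: heis_word_shift_def heisenberg_relations_def commutator_word_def inv_word_def
        fun_eq_iff)
qed (simp_all add: heis_word_shift_def)

text \<open>The orbit map of the origin, designed as a left inverse of \<open>heis_point\<close>. On
  classes of words the representative picked by \<open>SOME\<close> is immaterial, by
  \<open>heis_word_shift_cong\<close>.\<close>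

definition heis_coords :: "heis_gen word set \<Rightarrow> int \<times> int \<times> int" where
  "heis_coords U = heis_word_shift (SOME u. U = heis_elt u) (0, 0, 0)"

lemma heis_coords_elt: "heis_coords (heis_elt w) = heis_word_shift w (0, 0, 0)"
proof -
  have "heis_elt w = heis_elt (SOME u. heis_elt w = heis_elt u)"
    by (rule someI[where x = w]) simp
  then show ?thesis
    unfolding heis_coords_def heis_elt_eq_iff by (metis heis_word_shift_cong)
qed

lemma heis_coords_letter:
  assumes "g \<in> carrier heisenberg_group"
  shows "heis_coords (g \<star> heis_letter x) = heis_shift x 1 (heis_coords g)"
proof -
  obtain w where "g = heis_elt w"
    using assms by (rule heis_elt_cases)
  then show ?thesis
    by (simp add: heis_elt_append[symmetric] heis_coords_elt heis_word_shift_def)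
qed

lemma heis_coords_pow:
  fixes n :: int
  assumes g: "g \<in> carrier heisenberg_group"
  shows "heis_coords (g \<star> heis_letter x [^]\<^bsub>heisenberg_group\<^esub> n) = heis_shift x n (heis_coords g)"
proof (induction n rule: int_induct[where k = 0])
  case base
  show ?case using g by simp
next
  case (step1 n)
  have "g \<star> heis_letter x [^]\<^bsub>heisenberg_group\<^esub> (n + 1) =
      g \<star> heis_letter x [^]\<^bsub>heisenberg_group\<^esub> n \<star> heis_letter x"
    using g by (simp add: H.int_pow_mult H.m_assoc)
  then show ?case
    using g step1 by (simp add: heis_coords_letter)
next
  case (step2 n)
  let ?h = "g \<star> heis_letter x [^]\<^bsub>heisenberg_group\<^esub> (n - 1)"
  have "g \<star> heis_letter x [^]\<^bsub>heisenberg_group\<^esub> n = ?h \<star> heis_letter x"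
    using g H.int_pow_mult[of "heis_letter x" "n - 1" 1] by (simp add: H.m_assoc)
  then have "heis_shift x n (heis_coords g) = heis_shift x 1 (heis_coords ?h)"
    using g step2 by (simp add: heis_coords_letter)
  \<comment> \<open>In the downward step the value at \<open>n\<close> is known and the one at
    \<open>n - 1\<close> is sought, so the last shift is undone.\<close>
  then have "heis_shift x (- 1) (heis_shift x n (heis_coords g)) =
      heis_shift x (- 1) (heis_shift x 1 (heis_coords ?h))"
    by simp
  then show ?case
    by simp
qed

text \<open>Uniqueness of normal forms: the three powers act in turn on the origin. While
  \<open>b\<close> acts the first coordinate is 0, so the last one stays 0.\<close>

lemma heis_coords_point: "heis_coords (heis_point p) = p"
proof (cases p)
  case (fields x y z)
  have "heis_coords \<one>\<^bsub>heisenberg_group\<^esub> = (0, 0, 0)"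
    using heis_coords_elt[of "[]"] by (simp add: heis_elt_Nil heis_word_shift_def)
  then have "heis_coords (heis_letter Gen_b [^]\<^bsub>heisenberg_group\<^esub> y) = (0, y, 0)"
    using heis_coords_pow[of "\<one>\<^bsub>heisenberg_group\<^esub>" Gen_b y] by simp
  then show ?thesis
    by (simp add: fields heis_coords_pow)
qed

lemma infinite_heisenberg_group: "infinite (carrier heisenberg_group)"
proof -
  have "inj heis_point"
    by (metis heis_coords_point injI)
  moreover have "infinite (UNIV :: (int \<times> int \<times> int) set)"
    by (simp add: finite_prod)
  ultimately have "infinite (range heis_point)"
    using finite_imageD by blast
  then show ?thesis
    by (rule infinite_super[rotated]) auto
qed

lemma generate_heisenberg_group:
  "generate heisenberg_group (range heis_letter) = carrier heisenberg_group"
proof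
  show "generate heisenberg_group (range heis_letter) \<subseteq> carrier heisenberg_group"
    by (rule H.generate_incl) auto
  have sub: "subgroup (generate heisenberg_group (range heis_letter)) heisenberg_group"
    by (rule H.generate_is_subgroup) auto
  have "heis_letter x [^]\<^bsub>heisenberg_group\<^esub> (n :: int) \<in> generate heisenberg_group (range heis_letter)"
    for x n
    by (rule H.subgroup_int_pow_closed[OF sub]) (auto intro: generate.incl)
  then have "heis_point p \<in> generate heisenberg_group (range heis_letter)" for p
    by (cases p) (auto intro!: generate.eng)
  then show "carrier heisenberg_group \<subseteq> generate heisenberg_group (range heis_letter)"
    using surj_heis_point by blast
qed

section \<open>Connectedness outside cubes\<close>

definition cube :: "int \<Rightarrow> (int \<times> int \<times> int) set" where
  "cube N = {-N..N} \<times> {-N..N} \<times> {-N..N}"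

lemma finite_int_triples_subset_cube:
  assumes "finite S"
  shows "\<exists>N. S \<subseteq> cube N \<and> N \<ge> 0"
  using assms
proof (induction S)
  case (insert p S)
  then obtain N where N: "S \<subseteq> cube N" "N \<ge> 0" by blast
  obtain x y z where "p = (x, y, z)" by (cases p)
  then have "insert p S \<subseteq> cube (N + \<bar>x\<bar> + \<bar>y\<bar> + \<bar>z\<bar>)"
    using N by (fastforce simp: cube_def)
  then show ?case
    using N(2) by (intro exI[of _ "N + \<bar>x\<bar> + \<bar>y\<bar> + \<bar>z\<bar>"]) auto
qed auto

definition heis_edges_avoiding :: "heis_gen word set set \<Rightarrow> (heis_gen word set \<times> heis_gen word set) set" where
  "heis_edges_avoiding F = cayley_adj heisenberg_group (range heis_letter) \<inter>
     (carrier heisenberg_group - F) \<times> (carrier heisenberg_group - F)"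

lemma sym_heis_edges_avoiding: "sym ((heis_edges_avoiding F)\<^sup>*)"
  using sym_cayley_adj[of heisenberg_group "range heis_letter"]
  by (intro sym_rtrancl) (auto simp: heis_edges_avoiding_def sym_def)

text \<open>Requiring the whole line to miss \<open>F\<close>, not just a segment, lets the
  induction on \<open>n\<close> run in both directions without tracking bounds.\<close>

lemma heis_line_connected:
  assumes "\<And>k. heis_point (heis_shift g k p) \<notin> F"
  shows "(heis_point p, heis_point (heis_shift g n p)) \<in> (heis_edges_avoiding F)\<^sup>*"
proof -
  have edge: "(heis_point (heis_shift g k p), heis_point (heis_shift g (k + 1) p))
      \<in> (heis_edges_avoiding F)\<^sup>*" for k
    using assms heis_point_letter[of "heis_shift g k p" g]
    by (intro r_into_rtrancl) (auto simp: heis_edges_avoiding_def cayley_adj_def intro!: exI[of _ g])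
  show ?thesis
  proof (induction n rule: int_induct[where k = 0])
    case (step1 n)
    then show ?case
      using edge[of n] by simp
  next
    case (step2 n)
    have "(heis_point (heis_shift g n p), heis_point (heis_shift g (n - 1) p))
        \<in> (heis_edges_avoiding F)\<^sup>*"
      using edge[of "n - 1"] sym_heis_edges_avoiding by (simp add: symD)
    with step2 show ?case by simp
  qed simp
qed

lemma heis_connected_outside_cube:
  assumes F: "\<And>p. p \<notin> cube N \<Longrightarrow> heis_point p \<notin> F" and "N \<ge> 0" and p: "p \<notin> cube N"
  shows "(heis_point p, heis_point (0, N + 1, 0)) \<in> (heis_edges_avoiding F)\<^sup>*"
proof -
  note heis_point.simps [simp del]
  let ?conn = "\<lambda>p q. (heis_point p, heis_point q) \<in> (heis_edges_avoiding F)\<^sup>*"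
  have line: "?conn p (heis_shift g n p)" if "\<And>k. heis_shift g k p \<notin> cube N" for p g n
    using that by (intro heis_line_connected F)
  have cube_iff: "(x, y, z) \<notin> cube N \<longleftrightarrow> \<bar>x\<bar> > N \<or> \<bar>y\<bar> > N \<or> \<bar>z\<bar> > N" for x y z
    by (auto simp: cube_def)
  \<comment> \<open>The \<open>b\<close>-line and the \<open>c\<close>-line keep \<open>x\<close>
    fixed, so with \<bar>x\<bar> > N they miss the cube however the \<open>b\<close>-line skews
    \<open>z\<close>.\<close>
  have large_x: "?conn (x, y, z) (0, N + 1, 0)" if "\<bar>x\<bar> > N" for x y z
  proof -
    \<comment> \<open>The height at which the \<open>b\<close>-line reaches second coordinate
      \<open>N + 1\<close>: the shift by \<open>n = N + 1 - y\<close> adds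
      \<open>n * x\<close>.\<close>
    define z' where "z' = z + (N + 1 - y) * x"
    have "?conn (x, y, z) (x, N + 1, z')"
      using line[of Gen_b "(x, y, z)" "N + 1 - y"] that by (simp add: cube_iff z'_def)
    also have "?conn (x, N + 1, z') (x, N + 1, 0)"
      using line[of Gen_c "(x, N + 1, z')" "- z'"] that by (simp add: cube_iff)
    \<comment> \<open>This \<open>a\<close>-line crosses small values of \<open>x\<close>, but its
      second coordinate \<open>N + 1\<close> keeps it outside the cube.\<close>
    also have "?conn (x, N + 1, 0) (0, N + 1, 0)"
      using line[of Gen_a "(x, N + 1, 0)" "- x"] \<open>N \<ge> 0\<close> by (simp add: cube_iff)
    finally show ?thesis .
  qed
  obtain x y z where xyz: "p = (x, y, z)"
    by (cases p)
  show ?thesis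
  proof (cases "\<bar>x\<bar> > N")
    case True
    then show ?thesis
      unfolding xyz by (rule large_x)
  next
    case False
    \<comment> \<open>Here \<open>y\<close> or \<open>z\<close> is the large coordinate, and
      \<open>a\<close> changes neither.\<close>
    then have "heis_shift Gen_a k p \<notin> cube N" for k
      using p by (auto simp: xyz cube_iff)
    then have "?conn p (heis_shift Gen_a (N + 1 - x) p)"
      by (rule line)
    then have "?conn p (N + 1, y, z)"
      by (simp add: xyz)
    also have "?conn (N + 1, y, z) (0, N + 1, 0)"
      using \<open>N \<ge> 0\<close> by (intro large_x) simp
    finally show ?thesis .
  qed
qed

theorem proposition19: "has_one_end heisenberg_group"
proof (rule H.has_one_endI[OF infinite_heisenberg_group _ _ generate_heisenberg_group])
  have "(UNIV :: heis_gen set) = {Gen_a, Gen_b, Gen_c}"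
    using heis_gen.exhaust by blast
  then show "finite (range heis_letter)"
    by (metis finite.emptyI finite_imageI finite_insert)
  show "range heis_letter \<subseteq> carrier heisenberg_group"
    by auto
  fix F assume "finite F" "F \<subseteq> carrier heisenberg_group"
  obtain N where N: "heis_coords ` F \<subseteq> cube N" "N \<ge> 0"
    using finite_int_triples_subset_cube[of "heis_coords ` F"] \<open>finite F\<close> by auto
  have F: "heis_point p \<notin> F" if "p \<notin> cube N" for p
    using that N(1) by (metis heis_coords_point image_subset_iff)
  \<comment> \<open>The set \<open>K\<close> of the criterion is the image of the cube; outside it
    every element has coordinates off the cube and is joined to a common base point.\<close>
  have to_base: "(g, heis_point (0, N + 1, 0)) \<in> (heis_edges_avoiding F)\<^sup>*"
    if "g \<in> carrier heisenberg_group - heis_point ` cube N" for g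
    using that surj_heis_point[of g] heis_connected_outside_cube[OF F \<open>N \<ge> 0\<close>] by blast
  have "(g, h) \<in> (heis_edges_avoiding F)\<^sup>*"
    if "g \<in> carrier heisenberg_group - heis_point ` cube N"
      "h \<in> carrier heisenberg_group - heis_point ` cube N" for g h
    using to_base[OF that(1)] symD[OF sym_heis_edges_avoiding to_base[OF that(2)]]
    by (rule rtrancl_trans)
  moreover have "finite (heis_point ` cube N)"
    by (simp add: cube_def)
  ultimately show "\<exists>K. finite K \<and> (\<forall>g \<in> carrier heisenberg_group - K. \<forall>h \<in> carrier heisenberg_group - K.
      (g, h) \<in> (cayley_adj heisenberg_group (range heis_letter) \<inter>
        (carrier heisenberg_group - F) \<times> (carrier heisenberg_group - F))\<^sup>*)"
    unfolding heis_edges_avoiding_def by blast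
qed

end
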